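(* Let $\|\cdot\|$ be a norm on $\mathbb{R}^d$ (the source norm), with dual norm $\|\cdot\|_\star$, and let $\|\cdot\|^{\mathrm{sn}}_{\star(k)}$ be the associated generalized $k$-support norms. If $\|\cdot\|$ is orthant-monotonic and the normed space $(\mathbb{R}^d,\|\cdot\|_\star)$ is strictly convex, then $$\{y\in\mathbb{R}^d : \ell_0(y)\le k\}=\{y\in\mathbb{R}^d : \|y\|^{\mathrm{sn}}_{\star(k)}=\|y\|_\star\}=\{y\in\mathbb{R}^d : \|y\|^{\mathrm{sn}}_{\star(k)}\le\|y\|_\star\}\qquad\forall k\in\{0,1,\dots,d\},$$ and $$\ell_0(y)=\min\{k\in\{1,\dots,d\} : \|y\|^{\mathrm{sn}}_{\star(k)}=\|y\|_\star\}\qquad\forall y\in\mathbb{R}^d.$$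
   Context: $d\ge 1$ is an integer and $\mathbb{R}^d$ carries the standard scalar product $\langle\cdot,\cdot\rangle$. $\ell_0(y)$ is the number of nonzero components of $y\in\mathbb{R}^d$. The dual norm of a norm $\|\cdot\|$ is $\|y\|_\star=\sup_{\|x\|\le 1}\langle x,y\rangle$. For $K\subset\{1,\dots,d\}$, $x_K$ is the vector that coincides with $x$ on $K$ and is zero outside $K$. For $k\in\{1,\dots,d\}$, the generalized top-$k$ norm is $\|x\|^{\mathrm{tn}}_{(k)}=\sup\{\|x_K\| : K\subset\{1,\dots,d\},\ |K|\le k\}$, and the generalized $k$-support norm is its dual norm, $\|y\|^{\mathrm{sn}}_{\star(k)}=\sup\{\langle x,y\rangle : \|x\|^{\mathrm{tn}}_{(k)}\le 1\}$. For $k=0$ the expressions are read from the same two formulas (so $\|x\|^{\mathrm{tn}}_{(0)}=0$ for all $x$, and the second supremum, over all $x\in\mathbb{R}^d$, is $0$ if $y=0$ and $+\infty$ otherwise). A norm $\|\cdot\|$ is orthant-monotonic if, for all $x,x'\in\mathbb{R}^d$, ($|x_i|\le|x_i'|$ and $x_ix_i'\ge 0$ for all $i$) implies $\|x\|\le\|x'\|$. A normed space is strictly convex if every point of its unit sphere is an extreme point of its unit ball.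
   Formalization: The minimum formula over {1,…,d} is stated only for y ≠ 0, since at y = 0 it fails (ℓ0(0) = 0 but the minimum is 1); the formula with the minimum over {0,1,…,d} is stated for all y. *)

theory Defs
  imports "HOL-Analysis.Analysis"
begin

definition is_norm :: "('a::real_vector \<Rightarrow> real) \<Rightarrow> bool" where
  "is_norm N \<longleftrightarrow>
     (\<forall>x. 0 \<le> N x) \<and>
     (\<forall>x. N x = 0 \<longleftrightarrow> x = 0) \<and>
     (\<forall>a x. N (a *\<^sub>R x) = \<bar>a\<bar> * N x) \<and>
     (\<forall>x y. N (x + y) \<le> N x + N y)"

(* The supremum is a real one: if N is a norm, its unit ball is nonempty and bounded. *)
definition dual_norm :: "(real^'n \<Rightarrow> real) \<Rightarrow> real^'n \<Rightarrow> real" where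
  "dual_norm N y = (SUP x\<in>{x. N x \<le> 1}. x \<bullet> y)"

definition vec_restrict :: "'n set \<Rightarrow> real^'n \<Rightarrow> real^'n" where
  "vec_restrict K x = (\<chi> i. if i \<in> K then x $ i else 0)"

definition l0 :: "real^'n \<Rightarrow> nat" where
  "l0 y = card {i. y $ i \<noteq> 0}"

definition top_norm :: "(real^'n \<Rightarrow> real) \<Rightarrow> nat \<Rightarrow> real^'n \<Rightarrow> real" where
  "top_norm N k x = (SUP K\<in>{K. card K \<le> k}. N (vec_restrict K x))"

(* Extended-real valued because of k = 0: there top_norm N 0 vanishes identically, the supremum
   runs over the whole space, and it is infinite unless y = 0. *)
definition support_norm :: "(real^'n \<Rightarrow> real) \<Rightarrow> nat \<Rightarrow> real^'n \<Rightarrow> ereal" where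
  "support_norm N k y = (SUP x\<in>{x. top_norm N k x \<le> 1}. ereal (x \<bullet> y))"

definition orthant_monotonic :: "(real^'n \<Rightarrow> real) \<Rightarrow> bool" where
  "orthant_monotonic N \<longleftrightarrow>
     (\<forall>x x'. (\<forall>i. \<bar>x $ i\<bar> \<le> \<bar>x' $ i\<bar> \<and> x $ i * x' $ i \<ge> 0) \<longrightarrow> N x \<le> N x')"

definition strictly_convex_norm :: "('a::real_vector \<Rightarrow> real) \<Rightarrow> bool" where
  "strictly_convex_norm N \<longleftrightarrow> (\<forall>x. N x = 1 \<longrightarrow> x extreme_point_of {z. N z \<le> 1})"

end

theory Submission
  imports Defs
begin

text \<open>
  Two inequalities hold for formal reasons. Orthant-monotonicity makes every coordinate projection
  non-expansive for \<open>N\<close>, so \<open>top_norm N k \<le> N\<close> and the supremum defining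
  \<open>support_norm N k\<close> runs over a larger set than the one defining \<open>dual_norm N\<close>. Hence
  \<open>dual_norm N \<le> support_norm N k\<close> everywhere, and equality is the same as \<open>\<le>\<close>. Conversely, if
  \<open>y\<close> is supported on a set \<open>K\<close> with at most \<open>k\<close> elements, then \<open>x \<bullet> y\<close> only sees the
  restriction of \<open>x\<close> to \<open>K\<close>, whose norm is at most \<open>top_norm N k x\<close>; so equality holds when
  \<open>l0 y \<le> k\<close>.

  The remaining implication is geometric. The unit ball of \<open>support_norm N k\<close> is the convex hull of
  the \<open>k\<close>-sparse points of the dual unit ball (\<open>support_ball_subset_hull\<close>; a separation
  argument). If \<open>support_norm N k y \<le> dual_norm N y\<close> and \<open>y \<noteq> 0\<close>, then \<open>y\<close>
  divided by its dual norm lies in this hull and on the dual unit sphere. By strict convexity it is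
  an extreme point of the dual ball, hence also of the smaller hull; but an extreme point of a
  convex hull belongs to the generating set, so \<open>y\<close> is \<open>k\<close>-sparse.

  The formulas for \<open>l0 y\<close> as a minimum follow, since the set of admissible \<open>k\<close> is an interval
  that begins at \<open>l0 y\<close>.
\<close>

section \<open>Norms on Euclidean spaces\<close>

lemma is_normD:
  assumes "is_norm N"
  shows "0 \<le> N x" "N x = 0 \<longleftrightarrow> x = 0" "N (a *\<^sub>R x) = \<bar>a\<bar> * N x" "N (x + y) \<le> N x + N y"
  using assms by (auto simp: is_norm_def)

lemma is_norm_pos: "is_norm N \<Longrightarrow> x \<noteq> 0 \<Longrightarrow> 0 < N x"
  using is_normD(1)[of N x] is_normD(2)[of N x] by linarith

lemma is_norm_convex_on:
  assumes "is_norm N"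
  shows "convex_on UNIV N"
proof
  fix t :: real and x y
  assume "0 < t" "t < 1"
  then show "N ((1 - t) *\<^sub>R x + t *\<^sub>R y) \<le> (1 - t) * N x + t * N y"
    using is_normD(4)[OF assms, of "(1 - t) *\<^sub>R x" "t *\<^sub>R y"] by (simp add: is_normD(3)[OF assms])
qed simp

lemma is_norm_continuous_on:
  fixes N :: "'a::euclidean_space \<Rightarrow> real"
  assumes "is_norm N"
  shows "continuous_on S N"
  using convex_on_continuous[OF open_UNIV is_norm_convex_on[OF assms]] continuous_on_subset by blast

lemma is_norm_ball_convex:
  assumes "is_norm N"
  shows "convex {x. N x \<le> c}"
proof (rule convexI)
  fix x y and u v :: real
  assume xy: "x \<in> {x. N x \<le> c}" "y \<in> {x. N x \<le> c}" and uv: "0 \<le> u" "0 \<le> v" "u + v = 1"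
  have "N (u *\<^sub>R x + v *\<^sub>R y) \<le> u * N x + v * N y"
    using is_norm_convex_on[OF assms] uv by (simp add: convex_on_def)
  also have "\<dots> \<le> c"
    by (rule convex_bound_le) (use xy uv in auto)
  finally show "u *\<^sub>R x + v *\<^sub>R y \<in> {x. N x \<le> c}"
    by simp
qed

lemma is_norm_ball_closed:
  fixes N :: "'a::euclidean_space \<Rightarrow> real"
  assumes "is_norm N"
  shows "closed {x. N x \<le> c}"
  by (intro closed_Collect_le is_norm_continuous_on[OF assms] continuous_intros)

text \<open>All norms are equivalent: the positive lower bound is attained on the Euclidean unit sphere.\<close>

lemma is_norm_lower_bound:
  fixes N :: "'a::euclidean_space \<Rightarrow> real"
  assumes "is_norm N"
  obtains m where "0 < m" "\<And>x. m * norm x \<le> N x"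
proof -
  have "sphere (0::'a) 1 \<noteq> {}"
    by simp
  then obtain u where u: "u \<in> sphere 0 1" "\<And>x. x \<in> sphere 0 1 \<Longrightarrow> N u \<le> N x"
    using continuous_attains_inf[OF compact_sphere _ is_norm_continuous_on[OF assms]] by blast
  have "N u * norm x \<le> N x" for x
  proof (cases "x = 0")
    case False
    then have "N u \<le> N ((1 / norm x) *\<^sub>R x)"
      by (intro u) simp
    then show ?thesis
      using False by (simp add: is_normD(3)[OF assms] field_simps)
  qed (use is_normD(1)[OF assms] in auto)
  moreover have "0 < N u"
    using u(1) by (intro is_norm_pos[OF assms]) auto
  ultimately show thesis
    using that by blast
qed

lemma is_norm_ball_compact:
  fixes N :: "'a::euclidean_space \<Rightarrow> real"
  assumes "is_norm N"
  shows "compact {x. N x \<le> c}"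
proof -
  obtain m where m: "0 < m" "\<And>x. m * norm x \<le> N x"
    using is_norm_lower_bound[OF assms] by blast
  have "norm x \<le> c / m" if "N x \<le> c" for x
    using m(1) m(2)[of x] that by (simp add: field_simps)
  then have "bounded {x. N x \<le> c}"
    by (auto simp: bounded_iff)
  then show ?thesis
    using is_norm_ball_closed[OF assms] by (simp add: compact_eq_bounded_closed)
qed

section \<open>The dual norm\<close>

lemma dual_norm_bdd_above:
  fixes N :: "real^'n \<Rightarrow> real"
  assumes "is_norm N"
  shows "bdd_above ((\<lambda>x. x \<bullet> y) ` {x. N x \<le> 1})"
  by (intro bounded_imp_bdd_above compact_imp_bounded compact_continuous_image
      continuous_intros is_norm_ball_compact[OF assms])

lemma inner_le_dual_norm:
  assumes "is_norm N" "N x \<le> 1"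
  shows "x \<bullet> y \<le> dual_norm N y"
  unfolding dual_norm_def by (rule cSUP_upper[OF _ dual_norm_bdd_above]) (use assms in auto)

lemma dual_norm_le:
  assumes "is_norm N" "\<And>x. N x \<le> 1 \<Longrightarrow> x \<bullet> y \<le> c"
  shows "dual_norm N y \<le> c"
proof -
  have "N 0 \<le> 1"
    using is_normD(2)[OF assms(1), of 0] by simp
  then show ?thesis
    unfolding dual_norm_def by (intro cSUP_least) (use assms(2) in auto)
qed

lemma inner_le_norm_dual_norm:
  assumes "is_norm N"
  shows "x \<bullet> y \<le> N x * dual_norm N y"
proof (cases "x = 0")
  case False
  note pos = is_norm_pos[OF assms False]
  have "((1 / N x) *\<^sub>R x) \<bullet> y \<le> dual_norm N y"
    by (rule inner_le_dual_norm[OF assms]) (use pos in \<open>simp add: is_normD(3)[OF assms]\<close>)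
  then show ?thesis
    using pos by (simp add: field_simps)
qed (simp add: is_normD(2)[OF assms, of 0, simplified])

lemma dual_norm_nonneg:
  assumes "is_norm N"
  shows "0 \<le> dual_norm N y"
  using inner_le_dual_norm[OF assms, of 0 y] is_normD(2)[OF assms, of 0] by simp

lemma dual_norm_scaleR_le:
  assumes "is_norm N"
  shows "dual_norm N (a *\<^sub>R y) \<le> \<bar>a\<bar> * dual_norm N y"
proof (rule dual_norm_le[OF assms])
  fix x assume x: "N x \<le> 1"
  have "N (sgn a *\<^sub>R x) \<le> 1"
    using x is_normD(3)[OF assms, of "sgn a" x] by (auto simp: sgn_if)
  then have "\<bar>a\<bar> * ((sgn a *\<^sub>R x) \<bullet> y) \<le> \<bar>a\<bar> * dual_norm N y"
    by (intro mult_left_mono inner_le_dual_norm[OF assms]) auto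
  moreover have "\<bar>a\<bar> * ((sgn a *\<^sub>R x) \<bullet> y) = x \<bullet> (a *\<^sub>R y)"
    by (cases a "0::real" rule: linorder_cases) simp_all
  ultimately show "x \<bullet> (a *\<^sub>R y) \<le> \<bar>a\<bar> * dual_norm N y"
    by metis
qed

lemma is_norm_dual_norm:
  fixes N :: "real^'n \<Rightarrow> real"
  assumes "is_norm N"
  shows "is_norm (dual_norm N)"
proof -
  have zero: "dual_norm N y = 0 \<longleftrightarrow> y = 0" for y
  proof
    assume "dual_norm N y = 0"
    then have "y \<bullet> y \<le> 0"
      using inner_le_norm_dual_norm[OF assms, of y y] by simp
    then show "y = 0"
      by (meson inner_gt_zero_iff not_le)
  next
    assume "y = 0"
    then show "dual_norm N y = 0"
      using dual_norm_le[OF assms, of 0 0] dual_norm_nonneg[OF assms, of y] by simp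
  qed
  have scale: "dual_norm N (a *\<^sub>R y) = \<bar>a\<bar> * dual_norm N y" for a y
  proof (cases "a = 0")
    case True
    then show ?thesis
      using zero[of 0] by simp
  next
    case False
    \<comment> \<open>The reverse inequality is the same bound for the scalar \<open>1 / a\<close>.\<close>
    have "dual_norm N y \<le> \<bar>1 / a\<bar> * dual_norm N (a *\<^sub>R y)"
      using dual_norm_scaleR_le[OF assms, of "1 / a" "a *\<^sub>R y"] False by simp
    then have "\<bar>a\<bar> * dual_norm N y \<le> dual_norm N (a *\<^sub>R y)"
      using False by (simp add: field_simps)
    then show ?thesis
      using dual_norm_scaleR_le[OF assms, of a y] by simp
  qed
  have "dual_norm N (y + z) \<le> dual_norm N y + dual_norm N z" for y z
    by (rule dual_norm_le[OF assms]) (simp add: inner_add_right add_mono inner_le_dual_norm[OF assms])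
  then show ?thesis
    using zero scale dual_norm_nonneg[OF assms] by (simp add: is_norm_def)
qed

text \<open>The nontrivial half of biduality: a point outside the closed convex set \<open>{u. N u \<le> c}\<close> is
  separated from it by a hyperplane, whose normal vector has dual norm small enough to contradict
  the hypothesis after normalisation.\<close>

lemma norm_le_of_dual_ball:
  fixes N :: "real^'n \<Rightarrow> real"
  assumes N: "is_norm N" and "0 \<le> c"
    and le: "\<And>z. dual_norm N z \<le> 1 \<Longrightarrow> x \<bullet> z \<le> c"
  shows "N x \<le> c"
proof (rule ccontr)
  assume "\<not> N x \<le> c"
  then obtain a b where a: "a \<bullet> x < b" "\<And>u. N u \<le> c \<Longrightarrow> b < a \<bullet> u"
    using separating_hyperplane_closed_point[OF is_norm_ball_convex[OF N] is_norm_ball_closed[OF N],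
        of x c] by blast
  define z where "z = - a"
  have "N 0 \<le> c"
    using is_normD(2)[OF N, of 0] \<open>0 \<le> c\<close> by simp
  then have "b < 0"
    using a(2)[of 0] by simp
  then have "z \<noteq> 0"
    using a(1) by (auto simp: z_def)
  define r where "r = dual_norm N z"
  have "0 < r"
    unfolding r_def by (rule is_norm_pos[OF is_norm_dual_norm[OF N] \<open>z \<noteq> 0\<close>])
  have "c * r \<le> - b"
  proof (cases "c = 0")
    case False
    have "r \<le> - b / c"
      unfolding r_def
    proof (rule dual_norm_le[OF N])
      fix u assume "N u \<le> 1"
      then have "N (c *\<^sub>R u) \<le> c"
        using \<open>0 \<le> c\<close> mult_left_mono[of "N u" 1 c] by (simp add: is_normD(3)[OF N])
      then have "b < a \<bullet> (c *\<^sub>R u)"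
        by (rule a(2))
      then show "u \<bullet> z \<le> - b / c"
        using False \<open>0 \<le> c\<close> by (simp add: z_def field_simps inner_commute)
    qed
    then show ?thesis
      using False \<open>0 \<le> c\<close> by (simp add: field_simps)
  qed (use \<open>b < 0\<close> in simp)
  moreover have "x \<bullet> ((1 / r) *\<^sub>R z) \<le> c"
    by (rule le) (use \<open>0 < r\<close> in \<open>simp add: is_normD(3)[OF is_norm_dual_norm[OF N]] r_def\<close>)
  then have "x \<bullet> z \<le> c * r"
    using \<open>0 < r\<close> by (simp add: field_simps)
  ultimately show False
    using a(1) by (simp add: z_def inner_commute)
qed

section \<open>Coordinate restriction and the top-k norm\<close>

lemma vec_restrict_nth [simp]: "vec_restrict K x $ i = (if i \<in> K then x $ i else 0)"
  by (simp add: vec_restrict_def)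

lemma inner_vec_restrict: "vec_restrict K x \<bullet> y = x \<bullet> vec_restrict K y"
  by (auto simp: inner_vec_def intro!: sum.cong)

lemma vec_restrict_scaleR: "vec_restrict K (a *\<^sub>R x) = a *\<^sub>R vec_restrict K x"
  by (simp add: vec_eq_iff)

lemma linear_vec_restrict: "linear (vec_restrict K)"
  by (intro linearI) (simp_all add: vec_eq_iff)

lemma vec_restrict_eq_self_iff: "vec_restrict K y = y \<longleftrightarrow> {i. y $ i \<noteq> 0} \<subseteq> K"
  by (auto simp: vec_eq_iff)

lemma vec_restrict_norm_le:
  assumes "orthant_monotonic N"
  shows "N (vec_restrict K x) \<le> N x"
  using assms unfolding orthant_monotonic_def by simp

lemma dual_norm_vec_restrict_le:
  assumes "is_norm N" "orthant_monotonic N"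
  shows "dual_norm N (vec_restrict K y) \<le> dual_norm N y"
proof (rule dual_norm_le[OF assms(1)])
  fix x assume "N x \<le> 1"
  then have "N (vec_restrict K x) \<le> 1"
    using vec_restrict_norm_le[OF assms(2), of K x] by simp
  then show "x \<bullet> vec_restrict K y \<le> dual_norm N y"
    using inner_le_dual_norm[OF assms(1)] by (metis inner_vec_restrict)
qed

lemma top_norm_le_iff:
  "top_norm N k x \<le> c \<longleftrightarrow> (\<forall>K. card K \<le> k \<longrightarrow> N (vec_restrict K x) \<le> c)"
proof -
  have "{K::'a set. card K \<le> k} \<noteq> {}"
    by (auto intro: exI[of _ "{}"])
  then show ?thesis
    unfolding top_norm_def by (subst cSUP_le_iff) auto
qed

section \<open>Support norm and dual norm\<close>

lemma support_norm_le_iff: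
  "support_norm N k y \<le> ereal c \<longleftrightarrow> (\<forall>x. top_norm N k x \<le> 1 \<longrightarrow> x \<bullet> y \<le> c)"
  by (auto simp: support_norm_def SUP_le_iff)

lemma dual_norm_le_support_norm:
  assumes "is_norm N" "orthant_monotonic N"
  shows "ereal (dual_norm N y) \<le> support_norm N k y"
proof (rule ereal_le_real)
  fix c assume c: "support_norm N k y \<le> ereal c"
  have "dual_norm N y \<le> c"
  proof (rule dual_norm_le[OF assms(1)])
    fix x assume "N x \<le> 1"
    then have "top_norm N k x \<le> 1"
      using vec_restrict_norm_le[OF assms(2), of _ x] order_trans by (fastforce simp: top_norm_le_iff)
    then show "x \<bullet> y \<le> c"
      using c by (simp add: support_norm_le_iff)
  qed
  then show "ereal (dual_norm N y) \<le> ereal c"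
    by simp
qed

lemma support_norm_le_dual_norm_if_sparse:
  assumes "is_norm N" "l0 y \<le> k"
  shows "support_norm N k y \<le> ereal (dual_norm N y)"
  unfolding support_norm_le_iff
proof (intro allI impI)
  fix x assume x: "top_norm N k x \<le> 1"
  define K where "K = {i. y $ i \<noteq> 0}"
  have "N (vec_restrict K x) \<le> 1"
    using x assms(2) by (simp add: top_norm_le_iff l0_def K_def)
  then have "vec_restrict K x \<bullet> y \<le> dual_norm N y"
    by (rule inner_le_dual_norm[OF assms(1)])
  moreover have "vec_restrict K y = y"
    by (simp add: vec_restrict_eq_self_iff K_def)
  ultimately show "x \<bullet> y \<le> dual_norm N y"
    by (simp add: inner_vec_restrict)
qed

lemma sparse_iff_vec_restrict:
  "l0 y \<le> k \<longleftrightarrow> (\<exists>K. card K \<le> k \<and> vec_restrict K y = y)"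
proof
  assume "\<exists>K. card K \<le> k \<and> vec_restrict K y = y"
  then obtain K where "card K \<le> k" "{i. y $ i \<noteq> 0} \<subseteq> K"
    by (auto simp: vec_restrict_eq_self_iff)
  then show "l0 y \<le> k"
    using card_mono[of K "{i. y $ i \<noteq> 0}"] by (simp add: l0_def)
qed (auto simp: l0_def vec_restrict_eq_self_iff)

text \<open>Compactness of the sparse part of the dual ball is what makes its convex hull closed, so that
  separation applies to it. Sparsity is a closed condition because the \<open>k\<close>-sparse vectors form a
  finite union of coordinate subspaces.\<close>

lemma compact_sparse_dual_ball:
  fixes N :: "real^'n \<Rightarrow> real"
  assumes "is_norm N"
  shows "compact {z. l0 z \<le> k \<and> dual_norm N z \<le> 1}"
proof -
  have "closed {z :: real^'n. vec_restrict K z = z}" for K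
    by (intro closed_Collect_eq linear_continuous_on linear_vec_restrict[THEN linear_linear[THEN iffD2]]
        continuous_intros)
  then have "closed (\<Union>K\<in>{K. card K \<le> k}. {z :: real^'n. vec_restrict K z = z})"
    by (intro closed_UN) auto
  moreover have "{z. l0 z \<le> k \<and> dual_norm N z \<le> 1} =
      {z. dual_norm N z \<le> 1} \<inter> (\<Union>K\<in>{K. card K \<le> k}. {z. vec_restrict K z = z})"
    by (auto simp: sparse_iff_vec_restrict)
  ultimately show ?thesis
    using compact_Int_closed[OF is_norm_ball_compact[OF is_norm_dual_norm[OF assms]]] by simp
qed

text \<open>If \<open>y\<close> is outside the hull, a separating functional \<open>x\<close> is bounded by some \<open>c > 0\<close> on the
  sparse dual ball while \<open>x \<bullet> y > c\<close>. By biduality, the first bound says \<open>top_norm N k x \<le> c\<close>,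
  so \<open>x\<close> divided by \<open>c\<close> witnesses that the support norm of \<open>y\<close> exceeds 1. The constant \<open>c\<close> is
  positive because 0 is sparse; this lets the argument include \<open>k = 0\<close>, where the hull
  is \<open>{0}\<close>.\<close>

lemma support_ball_subset_hull:
  fixes N :: "real^'n \<Rightarrow> real"
  assumes N: "is_norm N" "orthant_monotonic N" and y: "support_norm N k y \<le> ereal 1"
  shows "y \<in> convex hull {z. l0 z \<le> k \<and> dual_norm N z \<le> 1}"
proof (rule ccontr)
  let ?U = "{z. l0 z \<le> k \<and> dual_norm N z \<le> 1}"
  assume "y \<notin> convex hull ?U"
  moreover have "closed (convex hull ?U)"
    by (intro compact_imp_closed compact_convex_hull compact_sparse_dual_ball N)
  ultimately obtain a b where ab: "a \<bullet> y < b" "\<And>z. z \<in> convex hull ?U \<Longrightarrow> b < a \<bullet> z"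
    using separating_hyperplane_closed_point[OF convex_convex_hull, of ?U y] by blast
  define x where "x = - a"
  define c where "c = - b"
  have xU: "x \<bullet> z < c" if "l0 z \<le> k" "dual_norm N z \<le> 1" for z
    using ab(2)[OF hull_inc, of z] that by (simp add: x_def c_def)
  have "0 < c"
    using xU[of 0] is_normD(2)[OF is_norm_dual_norm[OF N(1)], of 0] by (simp add: l0_def)
  have "N (vec_restrict K x) \<le> c" if K: "card K \<le> k" for K
  proof (rule norm_le_of_dual_ball[OF N(1)])
    fix z assume "dual_norm N z \<le> 1"
    then have "dual_norm N (vec_restrict K z) \<le> 1"
      using dual_norm_vec_restrict_le[OF N, of K z] by simp
    moreover have "l0 (vec_restrict K z) \<le> k"
      unfolding sparse_iff_vec_restrict using K by (intro exI[of _ K]) (simp add: vec_eq_iff)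
    ultimately show "vec_restrict K x \<bullet> z \<le> c"
      using xU[of "vec_restrict K z"] by (simp add: inner_vec_restrict)
  qed (use \<open>0 < c\<close> in simp)
  then have "top_norm N k ((1 / c) *\<^sub>R x) \<le> 1"
    using \<open>0 < c\<close> by (simp add: top_norm_le_iff vec_restrict_scaleR is_normD(3)[OF N(1)])
  then have "((1 / c) *\<^sub>R x) \<bullet> y \<le> 1"
    using y unfolding support_norm_le_iff by blast
  then have "x \<bullet> y \<le> c"
    using \<open>0 < c\<close> by (simp add: field_simps)
  then show False
    using ab(1) by (simp add: x_def c_def)
qed

lemma sparse_if_support_norm_le_dual_norm:
  fixes N :: "real^'n \<Rightarrow> real"
  assumes N: "is_norm N" "orthant_monotonic N" "strictly_convex_norm (dual_norm N)"
    and le: "support_norm N k y \<le> ereal (dual_norm N y)"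
  shows "l0 y \<le> k"
proof (cases "y = 0")
  case False
  let ?U = "{z. l0 z \<le> k \<and> dual_norm N z \<le> 1}"
  note dual = is_norm_dual_norm[OF N(1)]
  define r where "r = dual_norm N y"
  have r: "0 < r"
    unfolding r_def by (rule is_norm_pos[OF dual False])
  define w where "w = (1 / r) *\<^sub>R y"
  have "dual_norm N w = 1"
    using r by (simp add: w_def is_normD(3)[OF dual] flip: r_def)
  then have extreme: "w extreme_point_of {z. dual_norm N z \<le> 1}"
    using N(3) by (simp add: strictly_convex_norm_def)
  have "support_norm N k w \<le> ereal 1"
    using le r by (auto simp: support_norm_le_iff w_def simp flip: r_def)
  then have "w \<in> convex hull ?U"
    by (rule support_ball_subset_hull[OF N(1,2)])
  moreover have "convex hull ?U \<subseteq> {z. dual_norm N z \<le> 1}"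
    by (intro hull_minimal is_norm_ball_convex dual) auto
  ultimately have "w extreme_point_of (convex hull ?U)"
    using extreme by (auto simp: extreme_point_of_def)
  then have "l0 w \<le> k"
    using extreme_point_of_convex_hull by blast
  then show ?thesis
    using r by (simp add: w_def l0_def)
qed (simp add: l0_def)

theorem mainTheorem12:
  fixes N :: "real^'n \<Rightarrow> real"
  assumes "is_norm N"
    and "orthant_monotonic N"
    and "strictly_convex_norm (dual_norm N)"
  shows "(\<forall>k\<in>{0..CARD('n)}.
            {y. l0 y \<le> k} = {y. support_norm N k y = ereal (dual_norm N y)} \<and>
            {y. support_norm N k y = ereal (dual_norm N y)}
              = {y. support_norm N k y \<le> ereal (dual_norm N y)}) \<and>
         (\<forall>y. y \<noteq> 0 \<longrightarrow>
            l0 y = Min {k\<in>{1..CARD('n)}. support_norm N k y = ereal (dual_norm N y)}) \<and>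
         (\<forall>y. l0 y = Min {k\<in>{0..CARD('n)}. support_norm N k y = ereal (dual_norm N y)})"
proof -
  have le_iff: "support_norm N k y \<le> ereal (dual_norm N y) \<longleftrightarrow> l0 y \<le> k" for k y
    using support_norm_le_dual_norm_if_sparse[OF assms(1)]
      sparse_if_support_norm_le_dual_norm[OF assms] by blast
  have eq_iff: "support_norm N k y = ereal (dual_norm N y) \<longleftrightarrow> l0 y \<le> k" for k y
    using le_iff[of k y] dual_norm_le_support_norm[OF assms(1,2), of y k] by auto
  have l0_le: "l0 y \<le> CARD('n)" for y :: "real^'n"
    by (simp add: l0_def card_mono)
  have l0_pos: "1 \<le> l0 y" if "y \<noteq> 0" for y :: "real^'n"
    using that by (auto simp: l0_def vec_eq_iff Suc_le_eq card_gt_0_iff)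
  have "l0 y = Min {k\<in>{1..CARD('n)}. l0 y \<le> k}" if "y \<noteq> 0" for y :: "real^'n"
    using l0_le[of y] l0_pos[OF that] by (intro Min_eqI[symmetric]) auto
  moreover have "l0 y = Min {k\<in>{0..CARD('n)}. l0 y \<le> k}" for y :: "real^'n"
    using l0_le[of y] by (intro Min_eqI[symmetric]) auto
  ultimately show ?thesis
    by (simp add: eq_iff le_iff)
qed

end
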